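(* Let $f:[0,+\infty)\to[0,+\infty)$ be an amenable function. Then: (1) $f\in P_{MB}=P_{B}$ if and only if there exists $K\geqslant 1$ such that for every triangle triplet $(a,b,c)$, the values $(f(a),f(b),f(c))$ form a $K$-triangle triplet. (2) $f\in P_{M}$ if and only if for any triangle triplet $(a,b,c)$, the values $(f(a),f(b),f(c))$ form a triangle triplet as well. (3) $f\in P_{BS}$ if and only if for every $K_1\geqslant 1$ there exists $K_2\geqslant 1$ such that for every $K_1$-triangle triplet $(a,b,c)$, the values $(f(a),f(b),f(c))$ form a strong $K_2$-triangle triplet. (4) $f\in P_{S}$ if and only if for every $K_1\geqslant 1$ there exists $K_2\geqslant 1$ such that for every strong $K_1$-triangle triplet $(a,b,c)$, the values $(f(a),f(b),f(c))$ form a strong $K_2$-triangle triplet. (5) $f\in P_{SB}$ if and only if for every $K_1\geqslant 1$ there exists $K_2\geqslant 1$ such that for every strong $K_1$-triangle triplet $(a,b,c)$, the values $(f(a),f(b),f(c))$ form a $K_2$-triangle triplet. (6) $f\in P_{MS}$ if and only if there exists $K\geqslant 1$ such that for every triangle triplet $(a,b,c)$, the values $(f(a),f(b),f(c))$ form a strong $K$-triangle triplet. (7) $f\in P_{SM}$ if and only if for every $K\geqslant 1$ and every strong $K$-triangle triplet $(a,b,c)$, the values $(f(a),f(b),f(c))$ form a triangle triplet.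
   Context: A semimetric space is a non-empty set $X$ with a function $d:X\times X\to[0,+\infty)$ (a semimetric) such that for all $x,y\in X$: $d(x,y)=0$ iff $x=y$, and $d(x,y)=d(y,x)$. A semimetric space $(X,d)$ satisfies: (M) (metric space) if $d(x,z)\leqslant d(x,y)+d(y,z)$ for all $x,y,z\in X$; (S) (strong $b$-metric space) if there is a fixed $K\geqslant 1$ such that $d(x,z)\leqslant K d(x,y)+d(y,z)$ for all $x,y,z\in X$; (B) ($b$-metric space) if there is a fixed $K\geqslant 1$ such that $d(x,z)\leqslant K(d(x,y)+d(y,z))$ for all $x,y,z\in X$. For properties $A_1,A_2$ among these, $P_{A_1A_2}$ is the class of all functions $f:[0,+\infty)\to[0,+\infty)$ such that for every semimetric space $(X,d)$ satisfying $(A_1)$, $f\circ d$ is a semimetric and $(X,f\circ d)$ satisfies $(A_2)$; $P_{A}:=P_{AA}$. A function $f:[0,+\infty)\to[0,+\infty)$ is amenable if $f^{-1}[\{0\}]=\{0\}$. For $K\geqslant 1$ and $a,b,c\in[0,+\infty)$ with $a\geqslant b\geqslant c$, the triple $(a,b,c)$ is a triangle triplet if $a\leqslant b+c$; a $K$-triangle triplet if $a\leqslant K(b+c)$; a strong $K$-triangle triplet if $a\leqslant Kc+b$. A triple of non-negative numbers given in arbitrary order is said to be (or to form) one of these kinds of triplet if its rearrangement in non-increasing order is.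
   Formalization: In (3) the K_1-triangle triplets are restricted to positive a, b, c, since with zero entries (3) is false (f=0 at 0, 1 on (0,1], 2 beyond; triplet (2,1,0)); the classes range over semimetric spaces carried by subsets of an arbitrary infinite type. *)

theory Defs
  imports "HOL-Analysis.Abstract_Metric_Spaces" "HOL-Library.Multiset" "HOL-Library.FuncSet"
begin

text \<open>
  A space is a carrier \<open>X\<close> inside a type together with \<open>d\<close>, of which only the values on
  \<open>X\<close> matter. Similarly, functions from \<open>[0,\<infinity>)\<close> to itself are total functions on the reals
  of which only the values on \<open>{0..}\<close> matter.
\<close>

definition semimetric :: "'a set \<Rightarrow> ('a \<Rightarrow> 'a \<Rightarrow> real) \<Rightarrow> bool" where
  "semimetric X d \<longleftrightarrow> X \<noteq> {} \<and>
     (\<forall>x\<in>X. \<forall>y\<in>X. 0 \<le> d x y \<and> (d x y = 0 \<longleftrightarrow> x = y) \<and> d x y = d y x)"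

type_synonym 'a space_property = "'a set \<Rightarrow> ('a \<Rightarrow> 'a \<Rightarrow> real) \<Rightarrow> bool"

definition prop_M :: "'a space_property" where
  "prop_M X d \<longleftrightarrow> (\<forall>x\<in>X. \<forall>y\<in>X. \<forall>z\<in>X. d x z \<le> d x y + d y z)"

definition prop_S :: "'a space_property" where
  "prop_S X d \<longleftrightarrow> (\<exists>K\<ge>1. \<forall>x\<in>X. \<forall>y\<in>X. \<forall>z\<in>X. d x z \<le> K * d x y + d y z)"

definition prop_B :: "'a space_property" where
  "prop_B X d \<longleftrightarrow> (\<exists>K\<ge>1. \<forall>x\<in>X. \<forall>y\<in>X. \<forall>z\<in>X. d x z \<le> K * (d x y + d y z))"

text \<open>The library's metric spaces, which may be empty, agree with semimetric spaces with (M).\<close>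

lemma semimetric_prop_M_iff_Metric_space:
  "semimetric X d \<and> prop_M X d \<longleftrightarrow>
     X \<noteq> {} \<and> Metric_space X (\<lambda>x y. if x \<in> X \<and> y \<in> X then d x y else 0)"
  unfolding semimetric_def prop_M_def Metric_space_def
  by (auto split: if_splits)

text \<open>
  The class \<open>P\<^sub>A\<^sub>1\<^sub>A\<^sub>2\<close>. The spaces range over all carriers in the type \<open>'a\<close>, since HOL
  cannot quantify over types inside a formula; \<open>'a\<close> does not occur in the type of the result.
\<close>

definition P_class :: "'a space_property \<Rightarrow> 'a space_property \<Rightarrow> (real \<Rightarrow> real) set" where
  "P_class A1 A2 = {f \<in> {0..} \<rightarrow> {0..}. \<forall>X d. semimetric X d \<and> A1 X d \<longrightarrow>
     semimetric X (\<lambda>x y. f (d x y)) \<and> A2 X (\<lambda>x y. f (d x y))}"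

definition amenable :: "(real \<Rightarrow> real) \<Rightarrow> bool" where
  "amenable f \<longleftrightarrow> f -` {0} \<inter> {0..} = {0}"

definition nonincreasing_rearrangement ::
    "(real \<Rightarrow> real \<Rightarrow> real \<Rightarrow> bool) \<Rightarrow> real \<Rightarrow> real \<Rightarrow> real \<Rightarrow> bool" where
  "nonincreasing_rearrangement T x y z \<longleftrightarrow> 0 \<le> x \<and> 0 \<le> y \<and> 0 \<le> z \<and>
     (\<exists>a b c. {#a, b, c#} = {#x, y, z#} \<and> a \<ge> b \<and> b \<ge> c \<and> T a b c)"

definition triangle_triplet :: "real \<Rightarrow> real \<Rightarrow> real \<Rightarrow> bool" where
  "triangle_triplet = nonincreasing_rearrangement (\<lambda>a b c. a \<le> b + c)"

definition K_triangle_triplet :: "real \<Rightarrow> real \<Rightarrow> real \<Rightarrow> real \<Rightarrow> bool" where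
  "K_triangle_triplet K = nonincreasing_rearrangement (\<lambda>a b c. a \<le> K * (b + c))"

definition strong_K_triangle_triplet :: "real \<Rightarrow> real \<Rightarrow> real \<Rightarrow> real \<Rightarrow> bool" where
  "strong_K_triangle_triplet K = nonincreasing_rearrangement (\<lambda>a b c. a \<le> K * c + b)"

text \<open>
  For \<open>K > 1\<close> there are \<open>K\<close>-triangle triplets \<open>(a, b, 0)\<close> with \<open>a \<noteq> b\<close>, which are not the
  distances of any three points of a semimetric space. Because of them, a characterization of
  \<open>P\<^sub>B\<^sub>S\<close> that quantifies over all \<open>K\<close>-triangle triplets is false, and it has to be restricted to
  triplets of positive numbers (the triplets \<open>(a, a, 0)\<close> impose no condition on an amenable
  function).
\<close>

lemma P_BS_degenerate_triplets:
  fixes f :: "real \<Rightarrow> real"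
  defines "f \<equiv> \<lambda>t. if t \<le> 0 then 0 else if t \<le> 1 then 1 else 2"
  shows "amenable f" and "f \<in> P_class (prop_B :: 'a space_property) prop_S"
    and "K_triangle_triplet 2 2 1 0"
    and "\<not> strong_K_triangle_triplet K (f 2) (f 1) (f 0)"
proof -
  show "amenable f" by (auto simp: amenable_def f_def split: if_splits)
  show "f \<in> P_class (prop_B :: 'a space_property) prop_S"
  proof -
    have "semimetric X (\<lambda>x y. f (d x y)) \<and> prop_S X (\<lambda>x y. f (d x y))"
      if sm: "semimetric X d" for X :: "'a set" and d
    proof
      have f0: "f t = 0 \<longleftrightarrow> t = 0" if "0 \<le> t" for t using that by (auto simp: f_def)
      have pos: "0 \<le> f t" "f t \<le> 2" for t by (auto simp: f_def)
      have ge1: "1 \<le> f t" if "0 < t" for t using that by (auto simp: f_def)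
      show "semimetric X (\<lambda>x y. f (d x y))"
        using sm f0 pos unfolding semimetric_def by metis
      have "f (d x z) \<le> 1 * f (d x y) + f (d y z)" if "x \<in> X" "y \<in> X" "z \<in> X" for x y z
      proof (cases "x = y \<or> y = z")
        case True
        then show ?thesis using pos by (auto simp: add_increasing add_increasing2)
      next
        case False
        then have "0 < d x y" "0 < d y z"
          using sm that unfolding semimetric_def by (metis order_le_less)+
        then show ?thesis using ge1[of "d x y"] ge1[of "d y z"] pos(2)[of "d x z"] by simp
      qed
      then show "prop_S X (\<lambda>x y. f (d x y))" unfolding prop_S_def by (intro exI[of _ 1]) auto
    qed
    then show ?thesis using \<open>amenable f\<close> by (auto simp: P_class_def f_def)
  qed
  show "K_triangle_triplet 2 2 1 0"
    unfolding K_triangle_triplet_def nonincreasing_rearrangement_def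
    by (intro conjI exI[of _ 2] exI[of _ 1] exI[of _ 0]) auto
  show "\<not> strong_K_triangle_triplet K (f 2) (f 1) (f 0)"
  proof
    assume "strong_K_triangle_triplet K (f 2) (f 1) (f 0)"
    then obtain a b c :: real where eq: "{#a, b, c#} = {#2, 1, 0#}"
      and ord: "a \<ge> b" "b \<ge> c" and le: "a \<le> K * c + b"
      by (auto simp: strong_K_triangle_triplet_def nonincreasing_rearrangement_def f_def)
    have set_eq: "{a, b, c} = {2, 1, 0}" using arg_cong[OF eq, of set_mset] by simp
    have "a \<in> {2, 1, 0}" "c \<in> {2, 1, 0}" "2 \<in> {a, b, c}" "0 \<in> {a, b, c}"
      using set_eq by blast+
    then have "a = 2" "c = 0" using ord by auto
    moreover have "a + b + c = 3" using arg_cong[OF eq, of sum_mset] by simp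
    ultimately show False using le by simp
  qed
qed

end

theory Submission
  imports Defs
begin

text \<open>
  Each of (M), (S), (B) says that, for some \<open>K \<ge> 1\<close>, the inequality
  \<open>d x z \<le> p * d x y + q * d y z\<close> holds throughout the space, where \<open>(p, q)\<close> is \<open>(1, 1)\<close>, \<open>(K, 1)\<close>
  or \<open>(K, K)\<close>. For three distinct points, this amounts to six inequalities between their mutual
  distances, and for numbers in non-increasing order the inequality in the definition of the
  triplets implies the other five. So all seven characterizations are instances of a single one,
  \<open>P_class_weighted_iff\<close>: \<open>f\<close> belongs to the class iff for each \<open>K1\<close> there is a \<open>K2\<close> such that \<open>f\<close>
  maps positive triplets for \<open>K1\<close> to triplets for \<open>K2\<close>.

  Sufficiency is immediate, as the inequality has to be checked for three points at a time.
  For necessity, suppose that no \<open>K2\<close> serves a given \<open>K1\<close>. For every \<open>n\<close> there is then a positive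
  triplet for \<open>K1\<close> whose image is not a triplet for \<open>n + 1\<close>. Realize each of them by three points and
  glue these countably many three-point spaces at one common point (\<open>wedge_dist\<close>). The wedge still
  satisfies the inequality with the constant \<open>K1\<close>, and it embeds in the infinite type \<open>'a\<close>. After
  applying \<open>f\<close>, the \<open>n\<close>-th piece rules out all constants up to \<open>n + 1\<close>, so no constant is left.

  Two loose ends remain. A triangle triplet, or a strong \<open>K\<close>-triangle triplet, with a zero entry has
  the form \<open>(a, a, 0)\<close>, and so does its image, whence the restriction to positive triplets disappears
  unless the source is (B). The equality of the classes for (M)-(B) and (B)-(B) comes from
  iterating \<open>f (2 * t) \<le> 2 * K * f t\<close>: relaxing the source by a factor \<open>2 ^ n\<close> costs a factor
  \<open>(2 * K) ^ n\<close> in the target (\<open>relaxed_bound_of_doubling\<close>).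
\<close>

section \<open>Weighted triangle inequalities\<close>

text \<open>
  The six inequalities that three points with mutual distances \<open>a\<close>, \<open>b\<close>, \<open>c\<close> have to satisfy; there
  are six because the two weights make the inequality asymmetric.
\<close>

definition weighted_triplet :: "real \<Rightarrow> real \<Rightarrow> real \<Rightarrow> real \<Rightarrow> real \<Rightarrow> bool" where
  "weighted_triplet p q a b c \<longleftrightarrow>
     a \<le> p * b + q * c \<and> a \<le> p * c + q * b \<and>
     b \<le> p * a + q * c \<and> b \<le> p * c + q * a \<and>
     c \<le> p * a + q * b \<and> c \<le> p * b + q * a"

definition weighted_prop :: "(real \<Rightarrow> real) \<Rightarrow> (real \<Rightarrow> real) \<Rightarrow> 'a space_property" where
  "weighted_prop p q X d \<longleftrightarrow>
     (\<exists>K\<ge>1. \<forall>x\<in>X. \<forall>y\<in>X. \<forall>z\<in>X. d x z \<le> p K * d x y + q K * d y z)"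

text \<open>
  Monotonicity allows a constant to be replaced by a larger one; the lower bound \<open>1\<close> makes the
  inequality hold trivially when two of the three points coincide.
\<close>

definition weight :: "(real \<Rightarrow> real) \<Rightarrow> bool" where
  "weight w \<longleftrightarrow> mono w \<and> (\<forall>K\<ge>1. 1 \<le> w K)"

lemma weightD: "weight w \<Longrightarrow> 1 \<le> K \<Longrightarrow> 1 \<le> w K"
  by (simp add: weight_def)

lemma weight_mono: "weight w \<Longrightarrow> K \<le> L \<Longrightarrow> w K \<le> w L"
  by (simp add: weight_def monoD)

lemma weight_one: "weight (\<lambda>_. 1)" and weight_id: "weight (\<lambda>K. K)"
  by (simp_all add: weight_def mono_def)

lemma prop_M_weighted: "prop_M = weighted_prop (\<lambda>_. 1) (\<lambda>_. 1)"
  by (intro ext) (auto simp: prop_M_def weighted_prop_def)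

lemma prop_S_weighted: "prop_S = weighted_prop (\<lambda>K. K) (\<lambda>_. 1)"
  by (intro ext) (auto simp: prop_S_def weighted_prop_def)

lemma prop_B_weighted: "prop_B = weighted_prop (\<lambda>K. K) (\<lambda>K. K)"
  by (intro ext) (auto simp: prop_B_def weighted_prop_def distrib_left)

lemma weighted_triplet_mono:
  assumes "weighted_triplet p q a b c" "0 \<le> a" "0 \<le> b" "0 \<le> c" "p \<le> p'" "q \<le> q'"
  shows "weighted_triplet p' q' a b c"
proof -
  have "p * a \<le> p' * a" "p * b \<le> p' * b" "p * c \<le> p' * c"
    "q * a \<le> q' * a" "q * b \<le> q' * b" "q * c \<le> q' * c"
    using assms by (simp_all add: mult_right_mono)
  then show ?thesis
    using assms(1) unfolding weighted_triplet_def by linarith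
qed

lemma weighted_triplet_permute:
  assumes "{#a, b, c#} = {#x, y, z#}"
  shows "weighted_triplet p q a b c \<longleftrightarrow> weighted_triplet p q x y z"
  using assms unfolding weighted_triplet_def
  by (auto simp: add_eq_conv_ex add_mset_eq_single)

lemma ex_nonincreasing_rearrangement:
  fixes x y z :: "'b :: linorder"
  shows "\<exists>a b c. {#a, b, c#} = {#x, y, z#} \<and> a \<ge> b \<and> b \<ge> c"
proof -
  consider "x \<ge> y" "y \<ge> z" | "x \<ge> z" "z \<ge> y" | "y \<ge> x" "x \<ge> z" | "y \<ge> z" "z \<ge> x"
    | "z \<ge> x" "x \<ge> y" | "z \<ge> y" "y \<ge> x"
    by (meson linear)
  then show ?thesis
    by cases (metis add_mset_commute)+
qed

text \<open>
  In non-increasing order \<open>a \<ge> b \<ge> c\<close>, only \<open>a\<close> can violate an inequality, and the right-hand side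
  is smallest when the larger weight \<open>p\<close> is attached to the smallest number \<open>c\<close>.
\<close>

lemma weighted_triplet_sorted:
  assumes "1 \<le> q" "q \<le> p" "0 \<le> c" "c \<le> b" "b \<le> a"
  shows "weighted_triplet p q a b c \<longleftrightarrow> a \<le> p * c + q * b"
proof -
  have dominated: "s \<le> v * s" if "0 \<le> s" "1 \<le> v" for s v :: real
    using that mult_right_mono[of 1 v s] by simp
  have "0 \<le> (p - q) * (b - c)" using assms by simp
  then have "p * c + q * b \<le> p * b + q * c" by (simp add: algebra_simps)
  moreover have "a \<le> p * a" "a \<le> q * a" "0 \<le> p * b" "0 \<le> q * b" "0 \<le> p * c" "0 \<le> q * c"
    using assms by (auto intro: dominated)
  ultimately show ?thesis
    using assms unfolding weighted_triplet_def by linarith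
qed

lemma nonincreasing_rearrangement_iff_weighted_triplet:
  assumes "1 \<le> q" "q \<le> p"
  shows "nonincreasing_rearrangement (\<lambda>a b c. a \<le> p * c + q * b) x y z \<longleftrightarrow>
     0 \<le> x \<and> 0 \<le> y \<and> 0 \<le> z \<and> weighted_triplet p q x y z"
proof (cases "0 \<le> x \<and> 0 \<le> y \<and> 0 \<le> z")
  case True
  have sorted_iff: "a \<le> p * c + q * b \<longleftrightarrow> weighted_triplet p q x y z"
    if eq: "{#a, b, c#} = {#x, y, z#}" and ord: "a \<ge> b" "b \<ge> c" for a b c
  proof -
    have "c \<in># {#x, y, z#}" using eq by (metis union_single_eq_member add_mset_commute)
    then have "0 \<le> c" using True by auto
    then show ?thesis
      using weighted_triplet_sorted[OF assms] weighted_triplet_permute[OF eq] ord by blast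
  qed
  then show ?thesis
    using True ex_nonincreasing_rearrangement[of x y z]
    unfolding nonincreasing_rearrangement_def by blast
qed (auto simp: nonincreasing_rearrangement_def)

lemma triangle_triplet_iff:
  "triangle_triplet a b c \<longleftrightarrow> 0 \<le> a \<and> 0 \<le> b \<and> 0 \<le> c \<and> weighted_triplet 1 1 a b c"
  using nonincreasing_rearrangement_iff_weighted_triplet[of 1 1 a b c]
  by (simp add: triangle_triplet_def add.commute)

lemma K_triangle_triplet_iff:
  "1 \<le> K \<Longrightarrow> K_triangle_triplet K a b c \<longleftrightarrow>
     0 \<le> a \<and> 0 \<le> b \<and> 0 \<le> c \<and> weighted_triplet K K a b c"
  using nonincreasing_rearrangement_iff_weighted_triplet[of K K a b c]
  by (simp add: K_triangle_triplet_def distrib_left add.commute)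

lemma strong_K_triangle_triplet_iff:
  "1 \<le> K \<Longrightarrow> strong_K_triangle_triplet K a b c \<longleftrightarrow>
     0 \<le> a \<and> 0 \<le> b \<and> 0 \<le> c \<and> weighted_triplet K 1 a b c"
  using nonincreasing_rearrangement_iff_weighted_triplet[of 1 K a b c]
  by (simp add: strong_K_triangle_triplet_def)

section \<open>Wedges of three-point spaces\<close>

text \<open>
  The common point is \<open>None\<close>; the other two points of the \<open>n\<close>-th piece are \<open>Some (n, True)\<close> and
  \<open>Some (n, False)\<close>, at distances \<open>a n\<close> and \<open>b n\<close> from the common point and \<open>c n\<close> from each other.
\<close>

fun radius :: "(nat \<Rightarrow> real) \<Rightarrow> (nat \<Rightarrow> real) \<Rightarrow> (nat \<times> bool) option \<Rightarrow> real" where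
  "radius a b None = 0"
| "radius a b (Some (n, s)) = (if s then a n else b n)"

definition same_piece :: "(nat \<times> bool) option \<Rightarrow> (nat \<times> bool) option \<Rightarrow> bool" where
  "same_piece u v \<longleftrightarrow> (\<exists>n s t. u = Some (n, s) \<and> v = Some (n, t))"

definition wedge_dist ::
    "(nat \<Rightarrow> real) \<Rightarrow> (nat \<Rightarrow> real) \<Rightarrow> (nat \<Rightarrow> real) \<Rightarrow>
     (nat \<times> bool) option \<Rightarrow> (nat \<times> bool) option \<Rightarrow> real" where
  "wedge_dist a b c u v =
     (if u = v then 0 else if same_piece u v then c (fst (the u))
      else radius a b u + radius a b v)"

lemma same_piece_simps [simp]:
  "\<not> same_piece None v" "\<not> same_piece u None"
  "same_piece (Some (n, s)) (Some (m, t)) \<longleftrightarrow> n = m"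
  by (auto simp: same_piece_def)

lemma wedge_dist_values:
  "wedge_dist a b c None (Some (n, True)) = a n"
  "wedge_dist a b c None (Some (n, False)) = b n"
  "wedge_dist a b c (Some (n, True)) (Some (n, False)) = c n"
  "wedge_dist a b c (Some (n, True)) None = a n"
  "wedge_dist a b c (Some (n, False)) None = b n"
  "wedge_dist a b c (Some (n, False)) (Some (n, True)) = c n"
  by (simp_all add: wedge_dist_def)

lemma same_piece_sym: "same_piece u v \<Longrightarrow> same_piece v u"
  by (auto simp: same_piece_def)

lemma same_piece_trans: "same_piece u v \<Longrightarrow> same_piece v w \<Longrightarrow> same_piece u w"
  by (auto simp: same_piece_def)

lemma same_piece_pigeonhole:
  "same_piece u v \<Longrightarrow> same_piece v w \<Longrightarrow> u = v \<or> v = w \<or> u = w"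
  by (auto simp: same_piece_def)

lemma wedge_dist_sym: "wedge_dist a b c u v = wedge_dist a b c v u"
  by (auto simp: wedge_dist_def same_piece_def)

lemma semimetric_wedge_dist:
  assumes pos: "\<And>n. 0 < a n" "\<And>n. 0 < b n" "\<And>n. 0 < c n"
  shows "semimetric UNIV (wedge_dist a b c)"
proof -
  have radius_pos: "u \<noteq> None \<Longrightarrow> 0 < radius a b u" for u
    using pos by (cases u) auto
  have "0 < wedge_dist a b c u v" if "u \<noteq> v" for u v
    using that pos radius_pos[of u] radius_pos[of v]
    by (cases "u = None"; cases "v = None") (auto simp: wedge_dist_def)
  moreover have "wedge_dist a b c u u = 0" for u by (simp add: wedge_dist_def)
  ultimately show ?thesis
    using wedge_dist_sym[of a b c] unfolding semimetric_def
    by (metis UNIV_not_empty order.strict_implies_order order.strict_implies_not_eq order_refl)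
qed

text \<open>
  Gluing at a point does not worsen the weights. The distance between different pieces is measured
  through the common point, so the inequality for three points that are not all in one piece reduces
  to one inside a single piece where the common point is a vertex, namely as an endpoint of the side
  to be estimated (\<open>radius_left\<close>, \<open>radius_right\<close>) or as the intermediate point (\<open>across\<close>).
\<close>

lemma wedge_dist_weighted_triangle:
  assumes pos: "\<And>n. 0 < a n" "\<And>n. 0 < b n" "\<And>n. 0 < c n"
    and triplet: "\<And>n. weighted_triplet p q (a n) (b n) (c n)"
    and weights: "1 \<le> p" "1 \<le> q"
  shows "wedge_dist a b c u w \<le> p * wedge_dist a b c u v + q * wedge_dist a b c v w"
proof -
  let ?d = "wedge_dist a b c" and ?r = "radius a b"
  have dominated: "s \<le> t * s" if "0 \<le> s" "1 \<le> t" for s t :: real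
    using that mult_right_mono[of 1 t s] by simp
  have d_nonneg: "0 \<le> ?d u v" for u v
    using semimetric_wedge_dist[OF pos] by (simp add: semimetric_def)
  have r_nonneg: "0 \<le> ?r u" for u
    by (cases u) (auto intro: less_imp_le[OF pos(1)] less_imp_le[OF pos(2)])
  note p_dominated = dominated[OF d_nonneg weights(1)] dominated[OF r_nonneg weights(1)]
  note q_dominated = dominated[OF d_nonneg weights(2)] dominated[OF r_nonneg weights(2)]
  note nonneg = d_nonneg r_nonneg
  have radius_left: "?r u \<le> p * ?d u v + q * ?r v" if "same_piece u v" "u \<noteq> v" for u v
    using that triplet
    by (auto simp: same_piece_def wedge_dist_def weighted_triplet_def split: if_splits)
  have radius_right: "?r u \<le> p * ?r v + q * ?d v u" if "same_piece u v" "u \<noteq> v" for u v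
    using that triplet
    by (auto simp: same_piece_def wedge_dist_def weighted_triplet_def split: if_splits)
  have across: "?d u w \<le> p * ?r u + q * ?r w" if "same_piece u w" "u \<noteq> w" for u w
    using that triplet
    by (auto simp: same_piece_def wedge_dist_def weighted_triplet_def split: if_splits)
  have apart: "?d u v = ?r u + ?r v" if "\<not> same_piece u v" "u \<noteq> v" for u v
    using that by (simp add: wedge_dist_def)
  have d_self: "?d u u = 0" for u by (simp add: wedge_dist_def)
  have p_nonneg: "0 \<le> p * ?d u v" "0 \<le> p * ?r u" for u v using nonneg weights by simp_all
  have q_nonneg: "0 \<le> q * ?d u v" "0 \<le> q * ?r u" for u v using nonneg weights by simp_all
  show ?thesis
  proof (cases "u = v \<or> v = w \<or> u = w")
    case True
    then show ?thesis
      using p_nonneg(1)[of u v] q_nonneg(1)[of v w] p_dominated(1)[of u v]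
        q_dominated(1)[of v w] d_self by auto
  next
    case False
    then have ne: "u \<noteq> v" "v \<noteq> w" "u \<noteq> w" by auto
    consider (uw) "same_piece u w" "\<not> same_piece u v" "\<not> same_piece v w"
      | (uv) "\<not> same_piece u w" "same_piece u v" "\<not> same_piece v w"
      | (vw) "\<not> same_piece u w" "\<not> same_piece u v" "same_piece v w"
      | (none) "\<not> same_piece u w" "\<not> same_piece u v" "\<not> same_piece v w"
      using ne same_piece_sym same_piece_trans same_piece_pigeonhole by metis
    then show ?thesis
    proof cases
      case uw
      then show ?thesis
        using across[of u w] p_nonneg(2)[of v] q_nonneg(2)[of v] ne apart[of u v] apart[of v w]
        by (simp add: distrib_left)
    next
      case uv
      then show ?thesis
        using radius_left[of u v] q_dominated(2)[of w] ne apart[of u w] apart[of v w]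
        by (simp add: distrib_left)
    next
      case vw
      then show ?thesis
        using radius_right[of w v] same_piece_sym[of v w] p_dominated(2)[of u]
          ne apart[of u w] apart[of u v]
        by (simp add: distrib_left)
    next
      case none
      then show ?thesis
        using p_dominated(2)[of u] q_dominated(2)[of w] p_nonneg(2)[of v] q_nonneg(2)[of v]
          ne apart[of u w] apart[of u v] apart[of v w]
        by (simp add: distrib_left)
    qed
  qed
qed

section \<open>Transport to the ambient type\<close>

lemma semimetric_image:
  fixes h :: "'b \<Rightarrow> 'a"
  assumes "inj h"
  shows "semimetric (range h) (\<lambda>x y. d (inv h x) (inv h y)) \<longleftrightarrow> semimetric UNIV d"
  using assms by (simp add: semimetric_def inj_eq)

lemma weighted_prop_image:
  fixes h :: "'b \<Rightarrow> 'a"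
  assumes "inj h"
  shows "weighted_prop p q (range h) (\<lambda>x y. d (inv h x) (inv h y)) \<longleftrightarrow> weighted_prop p q UNIV d"
  using assms by (simp add: weighted_prop_def)

text \<open>
  Since a countable space embeds in every infinite type, a class defined by the spaces in one
  such type still decides about countable spaces over convenient types of points.
\<close>

lemma P_class_weightedD_countable:
  fixes d :: "'b :: countable \<Rightarrow> 'b \<Rightarrow> real"
  assumes inf: "infinite (UNIV :: 'a set)"
    and f: "f \<in> P_class (weighted_prop p1 q1 :: 'a space_property) (weighted_prop p2 q2)"
    and d: "semimetric UNIV d" "weighted_prop p1 q1 UNIV d"
  shows "semimetric UNIV (\<lambda>u v. f (d u v))" "weighted_prop p2 q2 UNIV (\<lambda>u v. f (d u v))"
proof -
  obtain g :: "nat \<Rightarrow> 'a" where "inj g"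
    using infinite_countable_subset[OF inf] by auto
  define h where "h = g \<circ> (to_nat :: 'b \<Rightarrow> nat)"
  have "inj h" using \<open>inj g\<close> by (simp add: h_def inj_compose)
  then show "semimetric UNIV (\<lambda>u v. f (d u v))" "weighted_prop p2 q2 UNIV (\<lambda>u v. f (d u v))"
    using f d semimetric_image[of h d] weighted_prop_image[of h p1 q1 d]
      semimetric_image[of h "\<lambda>u v. f (d u v)"] weighted_prop_image[of h p2 q2 "\<lambda>u v. f (d u v)"]
    unfolding P_class_def by auto
qed

section \<open>The common characterization\<close>

text \<open>
  Amenability is forced by the two-point spaces, so the classes contain amenable functions only.
\<close>

lemma amenable_if_P_class:
  assumes inf: "infinite (UNIV :: 'a set)"
    and weights: "weight p1" "weight q1"
    and f: "f \<in> P_class (weighted_prop p1 q1 :: 'a space_property) (weighted_prop p2 q2)"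
  shows "amenable f"
proof -
  have "f t = 0 \<longleftrightarrow> t = 0" if "0 \<le> t" for t
  proof -
    \<comment> \<open>The two points are at distance \<open>t\<close>, or at distance \<open>1\<close> if \<open>t = 0\<close>.\<close>
    define s where "s = (if t = 0 then 1 else t)"
    define d where "d = (\<lambda>u v :: bool. if u = v then 0 else s)"
    have s: "0 < s" using that by (simp add: s_def)
    have "semimetric UNIV d" using s by (auto simp: semimetric_def d_def)
    moreover have "weighted_prop p1 q1 UNIV d"
      unfolding weighted_prop_def
    proof (intro exI[of _ 1] conjI ballI)
      fix u v w :: bool
      have "s \<le> p1 1 * s" "s \<le> q1 1 * s"
        using s weightD[OF weights(1), of 1] weightD[OF weights(2), of 1] by simp_all
      then show "d u w \<le> p1 1 * d u v + q1 1 * d v w"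
        using s by (auto simp: d_def)
    qed simp
    ultimately have "semimetric UNIV (\<lambda>u v. f (d u v))"
      by (rule P_class_weightedD_countable[OF inf f])
    then have "f (d u v) = 0 \<longleftrightarrow> u = v" for u v by (simp add: semimetric_def)
    from this[of True True] this[of True False] show ?thesis
      by (auto simp: d_def s_def split: if_splits)
  qed
  then show ?thesis by (auto simp: amenable_def)
qed

lemma amenable_zero_iff: "amenable f \<Longrightarrow> 0 \<le> t \<Longrightarrow> f t = 0 \<longleftrightarrow> t = 0"
  unfolding amenable_def by (auto simp: set_eq_iff)

lemma semimetric_comp_amenable:
  assumes "amenable f" "f \<in> {0..} \<rightarrow> {0..}" "semimetric X d"
  shows "semimetric X (\<lambda>x y. f (d x y))"
  using assms amenable_zero_iff[of f] unfolding semimetric_def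
  by (auto simp: Pi_iff)

text \<open>
  The dependence of \<open>K2\<close> on \<open>K1\<close> alone is the point: each triplet by itself could be tested in a
  three-point space, but only a space containing all of them at once yields a common constant.
\<close>

lemma weighted_triplet_of_P_class:
  assumes inf: "infinite (UNIV :: 'a set)"
    and weights1: "weight p1" "weight q1" and weights2: "weight p2" "weight q2"
    and f: "f \<in> P_class (weighted_prop p1 q1 :: 'a space_property) (weighted_prop p2 q2)"
    and K1: "1 \<le> K1"
  shows "\<exists>K2\<ge>1. \<forall>a>0. \<forall>b>0. \<forall>c>0. weighted_triplet (p1 K1) (q1 K1) a b c \<longrightarrow>
     weighted_triplet (p2 K2) (q2 K2) (f a) (f b) (f c)"
proof (rule ccontr)
  assume contra: "\<not> ?thesis"
  have "\<exists>a b c. 0 < a \<and> 0 < b \<and> 0 < c \<and> weighted_triplet (p1 K1) (q1 K1) a b c \<and>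
      \<not> weighted_triplet (p2 (real n + 1)) (q2 (real n + 1)) (f a) (f b) (f c)" for n
    using contra by (auto dest!: spec[of _ "real n + 1"])
  then obtain a b c where pos: "\<And>n. 0 < a n" "\<And>n. 0 < b n" "\<And>n. 0 < c n"
    and source: "\<And>n. weighted_triplet (p1 K1) (q1 K1) (a n) (b n) (c n)"
    and target: "\<And>n. \<not> weighted_triplet (p2 (real n + 1)) (q2 (real n + 1))
        (f (a n)) (f (b n)) (f (c n))"
    by metis
  let ?d = "wedge_dist a b c"
  have sm: "semimetric UNIV ?d" by (rule semimetric_wedge_dist[OF pos])
  have "weighted_prop p1 q1 UNIV ?d"
    using wedge_dist_weighted_triangle[OF pos source] K1 weights1
    unfolding weighted_prop_def by (auto simp: weightD)
  then have "weighted_prop p2 q2 UNIV (\<lambda>u v. f (?d u v))"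
    by (rule P_class_weightedD_countable(2)[OF inf f sm])
  then obtain K where "1 \<le> K"
    and K: "\<And>u v w. f (?d u w) \<le> p2 K * f (?d u v) + q2 K * f (?d v w)"
    unfolding weighted_prop_def by auto
  obtain n where "K \<le> real n" using real_arch_simple by blast
  let ?o = "None" and ?u = "Some (n, True)" and ?v = "Some (n, False)"
  have "weighted_triplet (p2 K) (q2 K) (f (a n)) (f (b n)) (f (c n))"
    using K[of ?o ?u ?v] K[of ?u ?o ?v] K[of ?o ?v ?u] K[of ?v ?o ?u] K[of ?u ?v ?o] K[of ?v ?u ?o]
    unfolding weighted_triplet_def wedge_dist_values by blast
  moreover have "0 \<le> f t" if "0 < t" for t
    using f that by (simp add: P_class_def Pi_iff)
  then have "0 \<le> f (a n)" "0 \<le> f (b n)" "0 \<le> f (c n)"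
    using pos by blast+
  ultimately have "weighted_triplet (p2 (real n + 1)) (q2 (real n + 1))
      (f (a n)) (f (b n)) (f (c n))"
    using weight_mono[OF weights2(1), of K "real n + 1"] weight_mono[OF weights2(2), of K "real n + 1"]
      \<open>K \<le> real n\<close>
    by (auto elim: weighted_triplet_mono)
  then show False using target by blast
qed

lemma P_class_of_weighted_triplet:
  assumes weights2: "weight p2" "weight q2"
    and f: "f \<in> {0..} \<rightarrow> {0..}" "amenable f"
    and triplets: "\<And>K1. 1 \<le> K1 \<Longrightarrow> \<exists>K2\<ge>1. \<forall>a>0. \<forall>b>0. \<forall>c>0.
       weighted_triplet (p1 K1) (q1 K1) a b c \<longrightarrow>
       weighted_triplet (p2 K2) (q2 K2) (f a) (f b) (f c)"
  shows "f \<in> P_class (weighted_prop p1 q1) (weighted_prop p2 q2)"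
proof -
  have "weighted_prop p2 q2 X (\<lambda>x y. f (d x y))"
    if sm: "semimetric X d" and d: "weighted_prop p1 q1 X d" for X :: "'a set" and d
  proof -
    obtain K1 where "1 \<le> K1"
      and K1: "\<And>x y z. x \<in> X \<Longrightarrow> y \<in> X \<Longrightarrow> z \<in> X \<Longrightarrow> d x z \<le> p1 K1 * d x y + q1 K1 * d y z"
      using d unfolding weighted_prop_def by auto
    obtain K2 where "1 \<le> K2" and K2: "\<And>a b c. 0 < a \<Longrightarrow> 0 < b \<Longrightarrow> 0 < c \<Longrightarrow>
        weighted_triplet (p1 K1) (q1 K1) a b c \<Longrightarrow>
        weighted_triplet (p2 K2) (q2 K2) (f a) (f b) (f c)"
      using triplets[OF \<open>1 \<le> K1\<close>] by blast
    have p2: "1 \<le> p2 K2" and q2: "1 \<le> q2 K2"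
      using weights2 \<open>1 \<le> K2\<close> by (auto intro: weightD)
    have f0: "f 0 = 0" using f(2) amenable_zero_iff by auto
    have "f (d x z) \<le> p2 K2 * f (d x y) + q2 K2 * f (d y z)"
      if X: "x \<in> X" "y \<in> X" "z \<in> X" for x y z
    proof -
      have d_sym: "d y x = d x y" "d z x = d x z" "d z y = d y z"
        and d_pos: "u \<in> X \<Longrightarrow> v \<in> X \<Longrightarrow> u \<noteq> v \<Longrightarrow> 0 < d u v"
        and d_self: "u \<in> X \<Longrightarrow> d u u = 0" and d_nonneg: "0 \<le> d x y" "0 \<le> d y z"
        for u v
        using sm X unfolding semimetric_def by (metis order_le_less)+
      have f_nonneg: "0 \<le> f (d x y)" "0 \<le> f (d y z)"
        using f(1) d_nonneg by (auto simp: Pi_iff)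
      then have scaled: "f (d x y) \<le> p2 K2 * f (d x y)" "f (d y z) \<le> q2 K2 * f (d y z)"
        using mult_right_mono[OF p2] mult_right_mono[OF q2] by force+
      show ?thesis
      proof (cases "x = y \<or> y = z \<or> x = z")
        case True
        then show ?thesis using f_nonneg scaled X d_self f0 by auto
      next
        case False
        have "weighted_triplet (p1 K1) (q1 K1) (d x z) (d x y) (d y z)"
          using K1[of x y z] K1[of z y x] K1[of x z y] K1[of y z x] K1[of y x z] K1[of z x y] X
          by (simp add: weighted_triplet_def d_sym)
        then have "weighted_triplet (p2 K2) (q2 K2) (f (d x z)) (f (d x y)) (f (d y z))"
          using False X by (intro K2) (auto intro: d_pos)
        then show ?thesis by (simp add: weighted_triplet_def)
      qed
    qed
    then show ?thesis using \<open>1 \<le> K2\<close> unfolding weighted_prop_def by blast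
  qed
  then show ?thesis
    using f semimetric_comp_amenable by (auto simp: P_class_def)
qed

theorem P_class_weighted_iff:
  assumes "infinite (UNIV :: 'a set)"
    and "weight p1" "weight q1" "weight p2" "weight q2"
    and "f \<in> {0..} \<rightarrow> {0..}" "amenable f"
  shows "f \<in> P_class (weighted_prop p1 q1 :: 'a space_property) (weighted_prop p2 q2) \<longleftrightarrow>
     (\<forall>K1\<ge>1. \<exists>K2\<ge>1. \<forall>a>0. \<forall>b>0. \<forall>c>0. weighted_triplet (p1 K1) (q1 K1) a b c \<longrightarrow>
        weighted_triplet (p2 K2) (q2 K2) (f a) (f b) (f c))"
  using weighted_triplet_of_P_class[OF assms(1-5)] P_class_of_weighted_triplet[OF assms(4-7)]
  by blast

text \<open>
  If the second weight is \<open>1\<close>, a zero entry forces the other two to be equal, so degenerate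
  triplets have the form \<open>(t, t, 0)\<close> up to order, and so have their images. This breaks down for
  larger second weights: \<open>(2, 1, 0)\<close> satisfies the inequalities for \<open>p = q = 2\<close>.
\<close>

lemma weighted_triplet_positive_suffices:
  assumes f: "f \<in> {0..} \<rightarrow> {0..}" "amenable f" and weights: "1 \<le> p'" "1 \<le> q'"
  shows "(\<forall>a>0. \<forall>b>0. \<forall>c>0. weighted_triplet p 1 a b c \<longrightarrow>
        weighted_triplet p' q' (f a) (f b) (f c)) \<longleftrightarrow>
     (\<forall>a b c. 0 \<le> a \<and> 0 \<le> b \<and> 0 \<le> c \<and> weighted_triplet p 1 a b c \<longrightarrow>
        weighted_triplet p' q' (f a) (f b) (f c))" (is "?pos \<longleftrightarrow> ?nonneg")
proof
  assume pos: ?pos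
  have f0: "f 0 = 0" using f(2) amenable_zero_iff by auto
  have degenerate: "weighted_triplet p' q' (f t) (f t) 0" "weighted_triplet p' q' (f t) 0 (f t)"
    "weighted_triplet p' q' 0 (f t) (f t)" if "0 \<le> t" for t
  proof -
    have "0 \<le> f t" using f(1) that by (auto simp: Pi_iff)
    then have "f t \<le> p' * f t" "f t \<le> q' * f t" "0 \<le> f t"
      using mult_right_mono[OF weights(1)] mult_right_mono[OF weights(2)] by force+
    then show "weighted_triplet p' q' (f t) (f t) 0" "weighted_triplet p' q' (f t) 0 (f t)"
      "weighted_triplet p' q' 0 (f t) (f t)"
      by (simp_all add: weighted_triplet_def)
  qed
  show ?nonneg
  proof (intro allI impI)
    fix a b c :: real
    assume abc: "0 \<le> a \<and> 0 \<le> b \<and> 0 \<le> c \<and> weighted_triplet p 1 a b c"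
    then consider "0 < a" "0 < b" "0 < c" | "a = 0" "b = c" | "b = 0" "a = c" | "c = 0" "a = b"
      by (force simp: weighted_triplet_def)
    then show "weighted_triplet p' q' (f a) (f b) (f c)"
      by cases (use pos abc degenerate f0 in auto)
  qed
qed auto

section \<open>From metric spaces to b-metric spaces\<close>

text \<open>
  After \<open>n\<close> halvings \<open>a\<close> has become at most \<open>b + c\<close>, and each halving costs a factor
  \<open>2 * K\<close>, by the triplet \<open>(a, a / 2, a / 2)\<close>.
  The halved number need not form a triangle with \<open>b\<close> and \<open>c\<close>, because it may be too small; it
  does form one with \<open>b + c\<close> and \<open>b + c\<close>, and \<open>b + c\<close> with \<open>b\<close> and \<open>c\<close>.
\<close>

lemma relaxed_bound_of_doubling:
  fixes f :: "real \<Rightarrow> real"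
  assumes K: "0 \<le> K"
    and triangle: "\<And>a b c. 0 < a \<Longrightarrow> 0 < b \<Longrightarrow> 0 < c \<Longrightarrow> weighted_triplet 1 1 a b c \<Longrightarrow>
       f a \<le> K * (f b + f c)"
    and "0 < a" "0 < b" "0 < c" "a \<le> 2 ^ n * (b + c)"
  shows "f a \<le> (2 * K) ^ n * (2 * K\<^sup>2 * (f b + f c))"
  using \<open>0 < a\<close> \<open>a \<le> 2 ^ n * (b + c)\<close>
proof (induction n arbitrary: a)
  case 0
  have "f a \<le> K * (f (b + c) + f (b + c))"
    using 0 \<open>0 < b\<close> \<open>0 < c\<close> by (intro triangle) (auto simp: weighted_triplet_def)
  also have "\<dots> = 2 * K * f (b + c)" by simp
  also have "\<dots> \<le> 2 * K * (K * (f b + f c))"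
    using K \<open>0 < b\<close> \<open>0 < c\<close> by (intro mult_left_mono triangle) (auto simp: weighted_triplet_def)
  finally show ?case by (simp add: power2_eq_square mult.assoc)
next
  case (Suc n)
  have "f a \<le> K * (f (a / 2) + f (a / 2))"
    using Suc.prems by (intro triangle) (auto simp: weighted_triplet_def)
  also have "\<dots> = 2 * K * f (a / 2)" by simp
  also have "\<dots> \<le> 2 * K * ((2 * K) ^ n * (2 * K\<^sup>2 * (f b + f c)))"
    using K Suc.prems by (intro mult_left_mono Suc.IH) auto
  finally show ?case by (simp add: mult.assoc)
qed

lemma weighted_triplet_relax:
  fixes f :: "real \<Rightarrow> real"
  assumes K: "1 \<le> K"
    and triangle: "\<forall>a>0. \<forall>b>0. \<forall>c>0. weighted_triplet 1 1 a b c \<longrightarrow>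
       weighted_triplet K K (f a) (f b) (f c)"
  shows "\<exists>K2\<ge>1. \<forall>a>0. \<forall>b>0. \<forall>c>0. weighted_triplet K1 K1 a b c \<longrightarrow>
     weighted_triplet K2 K2 (f a) (f b) (f c)"
proof -
  obtain n where n: "K1 \<le> 2 ^ n"
    using real_arch_pow[of 2 K1] by (auto intro: less_imp_le)
  let ?K2 = "(2 * K) ^ n * (2 * K\<^sup>2)"
  have triangle': "f a \<le> K * (f b + f c)"
    if "0 < a" "0 < b" "0 < c" "weighted_triplet 1 1 a b c" for a b c
    using triangle that by (simp add: weighted_triplet_def distrib_left)
  have bound: "f a \<le> ?K2 * (f b + f c)"
    if "0 < a" "0 < b" "0 < c" "a \<le> K1 * (b + c)" for a b c
  proof -
    have "K1 * (b + c) \<le> 2 ^ n * (b + c)" using n that by (intro mult_right_mono) auto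
    then have "a \<le> 2 ^ n * (b + c)" using that by linarith
    then have "f a \<le> (2 * K) ^ n * (2 * K\<^sup>2 * (f b + f c))"
      using K that by (intro relaxed_bound_of_doubling triangle') auto
    then show ?thesis by (simp add: mult.assoc)
  qed
  have "1 \<le> K\<^sup>2" using K by (simp add: one_le_power)
  then have "1 \<le> 2 * K\<^sup>2" by linarith
  then have "1 * 1 \<le> ?K2" using K by (intro mult_mono one_le_power) auto
  then have "1 \<le> ?K2" by simp
  moreover have "weighted_triplet ?K2 ?K2 (f a) (f b) (f c)"
    if "0 < a" "0 < b" "0 < c" "weighted_triplet K1 K1 a b c" for a b c
    using that bound[of a b c] bound[of b a c] bound[of c a b]
    by (simp add: weighted_triplet_def distrib_left add.commute)
  ultimately show ?thesis by blast
qed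

lemma P_class_MB_eq_B:
  assumes inf: "infinite (UNIV :: 'a set)"
  shows "P_class (prop_M :: 'a space_property) prop_B =
     P_class (prop_B :: 'a space_property) prop_B"
proof
  show "P_class (prop_B :: 'a space_property) prop_B \<subseteq>
      P_class (prop_M :: 'a space_property) prop_B"
  proof -
    have "prop_B X d" if "prop_M X d" for X :: "'a set" and d
      using that unfolding prop_M_def prop_B_def by (intro exI[of _ 1]) auto
    then show ?thesis unfolding P_class_def Collect_mono_iff by meson
  qed
  show "P_class (prop_M :: 'a space_property) prop_B \<subseteq>
      P_class (prop_B :: 'a space_property) prop_B"
  proof
    fix f assume f: "f \<in> P_class (prop_M :: 'a space_property) prop_B"
    then have am: "amenable f"
      unfolding prop_M_weighted prop_B_weighted
      by (rule amenable_if_P_class[OF inf weight_one weight_one])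
    have ran: "f \<in> {0..} \<rightarrow> {0..}" using f by (simp add: P_class_def)
    obtain K where "1 \<le> K" "\<forall>a>0. \<forall>b>0. \<forall>c>0. weighted_triplet 1 1 a b c \<longrightarrow>
        weighted_triplet K K (f a) (f b) (f c)"
      using weighted_triplet_of_P_class[OF inf weight_one weight_one weight_id weight_id
          f[unfolded prop_M_weighted prop_B_weighted], of 1] by auto
    then show "f \<in> P_class (prop_B :: 'a space_property) prop_B"
      unfolding prop_B_weighted
      by (intro P_class_of_weighted_triplet weight_id ran am weighted_triplet_relax)
  qed
qed

section \<open>The seven characterizations\<close>

theorem theorem4p1:
  fixes f :: "real \<Rightarrow> real"
  assumes "infinite (UNIV :: 'a set)"
    and "f \<in> {0..} \<rightarrow> {0..}"
    and "amenable f"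
  shows
    "P_class (prop_M :: 'a space_property) prop_B = P_class (prop_B :: 'a space_property) prop_B \<and>
     (f \<in> P_class (prop_M :: 'a space_property) prop_B \<longleftrightarrow>
       (\<exists>K\<ge>1. \<forall>a b c. triangle_triplet a b c \<longrightarrow> K_triangle_triplet K (f a) (f b) (f c))) \<and>
     (f \<in> P_class (prop_M :: 'a space_property) prop_M \<longleftrightarrow>
       (\<forall>a b c. triangle_triplet a b c \<longrightarrow> triangle_triplet (f a) (f b) (f c))) \<and>
     (f \<in> P_class (prop_B :: 'a space_property) prop_S \<longleftrightarrow>
       (\<forall>K1\<ge>1. \<exists>K2\<ge>1. \<forall>a>0. \<forall>b>0. \<forall>c>0. K_triangle_triplet K1 a b c \<longrightarrow>
          strong_K_triangle_triplet K2 (f a) (f b) (f c))) \<and>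
     (f \<in> P_class (prop_S :: 'a space_property) prop_S \<longleftrightarrow>
       (\<forall>K1\<ge>1. \<exists>K2\<ge>1. \<forall>a b c. strong_K_triangle_triplet K1 a b c \<longrightarrow>
          strong_K_triangle_triplet K2 (f a) (f b) (f c))) \<and>
     (f \<in> P_class (prop_S :: 'a space_property) prop_B \<longleftrightarrow>
       (\<forall>K1\<ge>1. \<exists>K2\<ge>1. \<forall>a b c. strong_K_triangle_triplet K1 a b c \<longrightarrow>
          K_triangle_triplet K2 (f a) (f b) (f c))) \<and>
     (f \<in> P_class (prop_M :: 'a space_property) prop_S \<longleftrightarrow>
       (\<exists>K\<ge>1. \<forall>a b c. triangle_triplet a b c \<longrightarrow>
          strong_K_triangle_triplet K (f a) (f b) (f c))) \<and>
     (f \<in> P_class (prop_S :: 'a space_property) prop_M \<longleftrightarrow>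
       (\<forall>K\<ge>1. \<forall>a b c. strong_K_triangle_triplet K a b c \<longrightarrow>
          triangle_triplet (f a) (f b) (f c)))"
proof -
  note inf = assms(1) and f = assms(2,3)
  have range: "0 \<le> f t" if "0 \<le> t" for t using f(1) that by (auto simp: Pi_iff)
  note char = P_class_weighted_iff[OF inf _ _ _ _ f]
  note weights = weight_one weight_id
  note props = prop_M_weighted prop_S_weighted prop_B_weighted
  note total = weighted_triplet_positive_suffices[OF f]
  have MB: "f \<in> P_class (prop_M :: 'a space_property) prop_B \<longleftrightarrow>
      (\<exists>K\<ge>1. \<forall>a b c. triangle_triplet a b c \<longrightarrow> K_triangle_triplet K (f a) (f b) (f c))"
    unfolding props
    by (subst char) (auto simp: weights total triangle_triplet_iff K_triangle_triplet_iff range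
        cong: conj_cong)
  have MM: "f \<in> P_class (prop_M :: 'a space_property) prop_M \<longleftrightarrow>
      (\<forall>a b c. triangle_triplet a b c \<longrightarrow> triangle_triplet (f a) (f b) (f c))"
    unfolding props
    by (subst char) (auto simp: weights total triangle_triplet_iff range cong: conj_cong)
  have BS: "f \<in> P_class (prop_B :: 'a space_property) prop_S \<longleftrightarrow>
      (\<forall>K1\<ge>1. \<exists>K2\<ge>1. \<forall>a>0. \<forall>b>0. \<forall>c>0. K_triangle_triplet K1 a b c \<longrightarrow>
         strong_K_triangle_triplet K2 (f a) (f b) (f c))"
    unfolding props
    by (subst char) (auto simp: weights K_triangle_triplet_iff strong_K_triangle_triplet_iff range
        cong: conj_cong)
  have SS: "f \<in> P_class (prop_S :: 'a space_property) prop_S \<longleftrightarrow>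
      (\<forall>K1\<ge>1. \<exists>K2\<ge>1. \<forall>a b c. strong_K_triangle_triplet K1 a b c \<longrightarrow>
         strong_K_triangle_triplet K2 (f a) (f b) (f c))"
    unfolding props
    by (subst char) (auto simp: weights total strong_K_triangle_triplet_iff range cong: conj_cong)
  have SB: "f \<in> P_class (prop_S :: 'a space_property) prop_B \<longleftrightarrow>
      (\<forall>K1\<ge>1. \<exists>K2\<ge>1. \<forall>a b c. strong_K_triangle_triplet K1 a b c \<longrightarrow>
         K_triangle_triplet K2 (f a) (f b) (f c))"
    unfolding props
    by (subst char) (auto simp: weights total strong_K_triangle_triplet_iff K_triangle_triplet_iff
        range cong: conj_cong)
  have MS: "f \<in> P_class (prop_M :: 'a space_property) prop_S \<longleftrightarrow>
      (\<exists>K\<ge>1. \<forall>a b c. triangle_triplet a b c \<longrightarrow> strong_K_triangle_triplet K (f a) (f b) (f c))"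
    unfolding props
    by (subst char) (auto simp: weights total triangle_triplet_iff strong_K_triangle_triplet_iff
        range cong: conj_cong)
  have SM: "f \<in> P_class (prop_S :: 'a space_property) prop_M \<longleftrightarrow>
      (\<forall>K\<ge>1. \<forall>a b c. strong_K_triangle_triplet K a b c \<longrightarrow> triangle_triplet (f a) (f b) (f c))"
    unfolding props
    by (subst char) (auto simp: weights total strong_K_triangle_triplet_iff triangle_triplet_iff
        range cong: conj_cong)
  show ?thesis
    using P_class_MB_eq_B[OF inf] MB MM BS SS SB MS SM by (intro conjI)
qed

end
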